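(* Let $f:2^{[n]}\to\mathbb{R}$ be an XOS function. Then there exists a set $V\subseteq\mathbb{R}^n$ such that for every $A\subseteq[n]$, $$f(A)=\frac{1}{n}\,\mathbb{E}_{\sigma\sim\{-1,1\}^A}\Big[\max_{v\in V}\sum_{i\in A}\sigma_i v_i\Big],$$ where $\sigma$ is uniform on $\{-1,1\}^A$.
   Context: A set function $f:2^{[n]}\to\mathbb{R}$ is XOS if there is a nonempty finite set $C$ and nonnegative weights $w_{ci}\ge0$ ($c\in C$, $i\in[n]$) such that $f(A)=\max_{c\in C}\sum_{i\in A}w_{ci}$ for all $A\subseteq[n]$. *)

theory Defs
  imports "HOL-Probability.Probability"
begin

text \<open>
  The ground set $[n]$ is the universe of a finite type \<open>'n\<close>, so that $n$ is \<open>CARD('n)\<close> and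
  $n \geq 1$. Finite index sets are taken inside \<open>nat\<close>, which loses no generality.
\<close>

definition xos :: "('n::finite set \<Rightarrow> real) \<Rightarrow> bool" where
  "xos f \<longleftrightarrow> (\<exists>(C :: nat set) (w :: nat \<Rightarrow> 'n \<Rightarrow> real).
     finite C \<and> C \<noteq> {} \<and> (\<forall>c\<in>C. \<forall>i. 0 \<le> w c i) \<and>
     (\<forall>A. f A = (MAX c\<in>C. \<Sum>i\<in>A. w c i)))"

text \<open>
  A maximum over a possibly infinite set need not exist; \<open>maximum_over\<close> is meaningful only
  together with \<open>attains_max\<close>.
\<close>

definition attains_max :: "('a \<Rightarrow> real) \<Rightarrow> 'a set \<Rightarrow> bool" where
  "attains_max g V \<longleftrightarrow> (\<exists>v\<in>V. \<forall>u\<in>V. g u \<le> g v)"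

definition maximum_over :: "('a \<Rightarrow> real) \<Rightarrow> 'a set \<Rightarrow> real" where
  "maximum_over g V = (GREATEST y. y \<in> g ` V)"

definition sign_vectors :: "'n set \<Rightarrow> ('n \<Rightarrow> real) set" where
  "sign_vectors A = A \<rightarrow>\<^sub>E {-1, 1}"

end

(* If V is closed under changing the signs of coordinates, then the maximum over V of the
   signed sum over A does not depend on the signs, so the expectation is that of a constant.
   Taking V to be all sign changes of the weight vectors, scaled by n, makes this constant n f(A). *)
theory Submission
  imports Defs
begin

lemma maximum_over_eqI:
  assumes "v \<in> V" "g v = m" "\<And>u. u \<in> V \<Longrightarrow> g u \<le> m"
  shows "attains_max g V" "maximum_over g V = m"
proof -
  show "attains_max g V"
    using assms unfolding attains_max_def by blast
  show "maximum_over g V = m"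
    unfolding maximum_over_def by (rule Greatest_equality) (use assms in auto)
qed

text \<open>Signs can only lose: each term \<open>\<sigma> i * v $ i\<close> is at most
  \<open>\<bar>v $ i\<bar>\<close>, which is a coordinate of a member of \<open>W\<close>, so no
  signed sum exceeds the largest plain sum. Equality occurs at the sign change of \<open>w\<close>
  that agrees with \<open>\<sigma>\<close> on \<open>A\<close>. Nonnegativity of \<open>w\<close>
  puts that vector in \<open>V\<close>.\<close>

lemma max_signed_sum:
  fixes W :: "(real ^ 'n::finite) set" and \<sigma> :: "'n \<Rightarrow> real"
  assumes \<sigma>: "\<sigma> \<in> sign_vectors A"
    and w: "w \<in> W" "\<And>i. 0 \<le> w $ i"
    and max: "\<And>u. u \<in> W \<Longrightarrow> (\<Sum>i\<in>A. u $ i) \<le> (\<Sum>i\<in>A. w $ i)"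
  defines "V \<equiv> {v. \<exists>u\<in>W. \<forall>i. \<bar>v $ i\<bar> = u $ i}"
  shows "attains_max (\<lambda>v. \<Sum>i\<in>A. \<sigma> i * v $ i) V"
    and "maximum_over (\<lambda>v. \<Sum>i\<in>A. \<sigma> i * v $ i) V = (\<Sum>i\<in>A. w $ i)"
proof -
  have sgn: "\<sigma> i = -1 \<or> \<sigma> i = 1" if "i \<in> A" for i
    using \<sigma> that unfolding sign_vectors_def by (auto simp: PiE_iff)
  \<comment> \<open>On \<open>A\<close> the two signs cancel, since
    \<open>\<sigma> i * \<sigma> i = 1\<close>. Off \<open>A\<close> the extensional function
    \<open>\<sigma>\<close> is \<open>undefined\<close>, so its absolute value is unknown and the
    coordinate of \<open>w\<close> is kept instead.\<close>
  define v where "v = (\<chi> i. if i \<in> A then \<sigma> i * w $ i else w $ i)"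
  have "\<bar>v $ i\<bar> = w $ i" for i
    using sgn[of i] w(2)[of i] by (auto simp: v_def)
  then have 1: "v \<in> V"
    using w(1) unfolding V_def by blast
  have 2: "(\<Sum>i\<in>A. \<sigma> i * v $ i) = (\<Sum>i\<in>A. w $ i)"
    by (rule sum.cong) (use sgn in \<open>force simp: v_def\<close>)+
  have 3: "(\<Sum>i\<in>A. \<sigma> i * x $ i) \<le> (\<Sum>i\<in>A. w $ i)" if "x \<in> V" for x
  proof -
    obtain u where u: "u \<in> W" "\<And>i. \<bar>x $ i\<bar> = u $ i"
      using \<open>x \<in> V\<close> unfolding V_def by blast
    \<comment> \<open>A product with a sign is at most the absolute value
      \<open>\<bar>x $ i\<bar>\<close>.\<close>
    have "\<sigma> i * x $ i \<le> u $ i" if "i \<in> A" for i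
      using sgn[OF that] u(2)[of i] by auto
    then have "(\<Sum>i\<in>A. \<sigma> i * x $ i) \<le> (\<Sum>i\<in>A. u $ i)"
      by (rule sum_mono)
    with max[OF u(1)] show ?thesis by linarith
  qed
  show "attains_max (\<lambda>v. \<Sum>i\<in>A. \<sigma> i * v $ i) V"
    and "maximum_over (\<lambda>v. \<Sum>i\<in>A. \<sigma> i * v $ i) V = (\<Sum>i\<in>A. w $ i)"
    using maximum_over_eqI[where g = "\<lambda>v. \<Sum>i\<in>A. \<sigma> i * v $ i", OF 1 2 3] by blast+
qed

lemma expectation_pmf_of_set_const:
  fixes k :: real
  assumes "finite S" "S \<noteq> {}" "\<And>x. x \<in> S \<Longrightarrow> g x = k"
  shows "measure_pmf.expectation (pmf_of_set S) g = k"
  using assms by (simp add: integral_pmf_of_set)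

theorem theoremA2:
  fixes f :: "'n::finite set \<Rightarrow> real"
  assumes "xos f"
  shows "\<exists>V :: (real ^ 'n) set. \<forall>A :: 'n set.
    (\<forall>\<sigma>\<in>sign_vectors A. attains_max (\<lambda>v. \<Sum>i\<in>A. \<sigma> i * v $ i) V) \<and>
    f A = 1 / real CARD('n) *
      measure_pmf.expectation (pmf_of_set (sign_vectors A))
        (\<lambda>\<sigma>. maximum_over (\<lambda>v. \<Sum>i\<in>A. \<sigma> i * v $ i) V)"
proof -
  obtain C :: "nat set" and w :: "nat \<Rightarrow> 'n \<Rightarrow> real"
    where C: "finite C" "C \<noteq> {}" and w: "\<And>c i. c \<in> C \<Longrightarrow> 0 \<le> w c i"
      and f: "\<And>A. f A = (MAX c\<in>C. \<Sum>i\<in>A. w c i)"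
    using assms unfolding xos_def by blast
  define n where "n = real CARD('n)"
  have n: "n > 0" by (simp add: n_def)
  \<comment> \<open>The factor \<open>n\<close> is there to cancel the normalisation
    \<open>1 / n\<close>; being positive, it preserves nonnegativity and the order of the
    sums.\<close>
  define W :: "(real ^ 'n) set" where "W = (\<lambda>c. \<chi> i. n * w c i) ` C"
  define V where "V = {v. \<exists>u\<in>W. \<forall>i. \<bar>v $ i\<bar> = u $ i}"
  have main: "attains_max (\<lambda>v. \<Sum>i\<in>A. \<sigma> i * v $ i) V \<and>
      maximum_over (\<lambda>v. \<Sum>i\<in>A. \<sigma> i * v $ i) V = n * f A"
    if \<sigma>: "\<sigma> \<in> sign_vectors A" for A \<sigma>
  proof -
    \<comment> \<open>The maximising index \<open>c\<close> may vary with \<open>A\<close>, while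
      \<open>V\<close> is the same for all \<open>A\<close>.\<close>
    have "f A \<in> (\<lambda>c. \<Sum>i\<in>A. w c i) ` C"
      unfolding f using C by (intro Max_in) auto
    then obtain c where c: "c \<in> C" "f A = (\<Sum>i\<in>A. w c i)" by blast
    define u :: "real ^ 'n" where "u = (\<chi> i. n * w c i)"
    have sum_u: "(\<Sum>i\<in>A. u $ i) = n * f A"
      by (simp add: u_def c(2) sum_distrib_left)
    have u: "u \<in> W" "\<And>i. 0 \<le> u $ i"
      using c(1) n w by (auto simp: W_def u_def)
    have max: "(\<Sum>i\<in>A. x $ i) \<le> (\<Sum>i\<in>A. u $ i)" if "x \<in> W" for x
    proof -
      obtain d where d: "d \<in> C" "x = (\<chi> i. n * w d i)"
        using \<open>x \<in> W\<close> unfolding W_def by blast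
      have "(\<Sum>i\<in>A. w d i) \<le> f A"
        unfolding f using C d(1) by (intro Max_ge) auto
      then show ?thesis
        using n unfolding sum_u by (simp add: d(2) flip: sum_distrib_left)
    qed
    show ?thesis
      using max_signed_sum[OF \<sigma> u max] unfolding V_def sum_u by blast
  qed
  have "f A = 1 / n * measure_pmf.expectation (pmf_of_set (sign_vectors A))
      (\<lambda>\<sigma>. maximum_over (\<lambda>v. \<Sum>i\<in>A. \<sigma> i * v $ i) V)" for A
  proof -
    \<comment> \<open>\<open>pmf_of_set\<close> is the uniform distribution only on a finite
      nonempty set. For empty \<open>A\<close> there is exactly one sign vector, so this case needs
      no separate treatment.\<close>
    have "finite (sign_vectors A)" "sign_vectors A \<noteq> {}"
      by (auto simp: sign_vectors_def PiE_eq_empty_iff intro!: finite_PiE)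
    then have "measure_pmf.expectation (pmf_of_set (sign_vectors A))
        (\<lambda>\<sigma>. maximum_over (\<lambda>v. \<Sum>i\<in>A. \<sigma> i * v $ i) V) = n * f A"
      using main by (intro expectation_pmf_of_set_const) blast+
    then show ?thesis using n by simp
  qed
  with main show ?thesis
    unfolding n_def by blast
qed

end
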